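(* For all integers $s > r \ge 2$, we have $\mathrm{ssat}(n, K_r, K_s) = n\binom{s-2}{r-1} - o(n)$ as $n \to \infty$.
   Context: A graph $G$ is strongly $F$-saturated if adding any edge (between two non-adjacent vertices) to $G$ creates a new copy of $F$; $G$ is not required to be $F$-free. $\mathrm{ssat}(n,H,F)$ denotes the minimum number of copies of $H$ in an $n$-vertex strongly $F$-saturated graph. $K_t$ denotes the complete graph on $t$ vertices. *)

theory Defs
  imports Complex_Main "HOL-Library.Ramsey" "HOL-Library.Landau_Symbols"
begin

type_synonym 'a graph = "'a set \<times> 'a set set"

definition simple_graph :: "'a graph \<Rightarrow> bool" where
  "simple_graph G \<longleftrightarrow> finite (fst G) \<and> snd G \<subseteq> [fst G]\<^bsup>2\<^esup>"

definition complete_graph :: "nat \<Rightarrow> nat graph" where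
  "complete_graph t = ({..<t}, [{..<t}]\<^bsup>2\<^esup>)"

definition subgraph :: "'a graph \<Rightarrow> 'a graph \<Rightarrow> bool" where
  "subgraph K G \<longleftrightarrow> simple_graph K \<and> fst K \<subseteq> fst G \<and> snd K \<subseteq> snd G"

definition graph_iso :: "'a graph \<Rightarrow> 'b graph \<Rightarrow> bool" where
  "graph_iso H K \<longleftrightarrow> (\<exists>f. bij_betw f (fst H) (fst K) \<and>
     (\<forall>u\<in>fst H. \<forall>v\<in>fst H. {u, v} \<in> snd H \<longleftrightarrow> {f u, f v} \<in> snd K))"

text \<open>Copies are subgraphs, not necessarily induced, and are counted without labels.\<close>

definition copies :: "'b graph \<Rightarrow> 'a graph \<Rightarrow> 'a graph set" where
  "copies H G = {K. subgraph K G \<and> graph_iso H K}"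

definition add_edge :: "'a \<Rightarrow> 'a \<Rightarrow> 'a graph \<Rightarrow> 'a graph" where
  "add_edge u v G = (fst G, insert {u, v} (snd G))"

definition strongly_saturated :: "'b graph \<Rightarrow> 'a graph \<Rightarrow> bool" where
  "strongly_saturated F G \<longleftrightarrow>
     (\<forall>u\<in>fst G. \<forall>v\<in>fst G. u \<noteq> v \<longrightarrow> {u, v} \<notin> snd G \<longrightarrow>
        (\<exists>K. K \<in> copies F (add_edge u v G) \<and> K \<notin> copies F G))"

text \<open>
  Every finite graph is isomorphic to one with vertices in \<^typ>\<open>nat\<close>, so it suffices to range over
  these. The set below is never empty, since complete graphs are vacuously strongly saturated;
  hence the infimum is a minimum.
\<close>

definition ssat :: "nat \<Rightarrow> 'b graph \<Rightarrow> 'c graph \<Rightarrow> nat" where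
  "ssat n H F = Inf {card (copies H G) | G :: nat graph.
     simple_graph G \<and> card (fst G) = n \<and> strongly_saturated F G}"

lemma ssat_attained:
  "\<exists>G :: nat graph. simple_graph G \<and> card (fst G) = n \<and> strongly_saturated F G \<and>
     card (copies H G) = ssat n H F"
proof -
  let ?S = "{card (copies H G) | G :: nat graph.
     simple_graph G \<and> card (fst G) = n \<and> strongly_saturated F G}"
  have "simple_graph (complete_graph n)" "card (fst (complete_graph n)) = n"
    "strongly_saturated F (complete_graph n)"
    by (auto simp: simple_graph_def complete_graph_def strongly_saturated_def)
  then have "?S \<noteq> {}" by blast
  then have "Inf ?S \<in> ?S" by (rule Inf_nat_def1)
  then show ?thesis unfolding ssat_def by (smt (verit) mem_Collect_eq)
qed

lemma finite_copies:
  assumes "simple_graph G"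
  shows "finite (copies H G)"
proof (rule finite_subset)
  show "copies H G \<subseteq> Pow (fst G) \<times> Pow (snd G)"
    by (auto simp: copies_def subgraph_def)
  have "finite (snd G)"
    using assms finite_imp_finite_nsets finite_subset unfolding simple_graph_def by blast
  then show "finite (Pow (fst G) \<times> Pow (snd G))"
    using assms by (simp add: simple_graph_def)
qed

end

theory Submission
  imports Defs
begin

text \<open>
  The upper bound comes from joining \<open>K\<^bsub>s-2\<^esub>\<close> to an independent set. For the lower bound, fix a
  constant \<open>K\<close> and let \<open>D\<close> be the set of vertices lying in at least \<open>K\<close> copies of \<open>K\<^bsub>r\<^esub>\<close>; by double
  counting, \<open>|D|\<close> is at most \<open>r/K\<close> times the number of copies. If a vertex \<open>v\<close> outside \<open>D\<close> is joined to
  an \<open>(s-2)\<close>-clique inside \<open>D\<close>, it yields \<open>binom(s-2, r-1)\<close> copies whose only vertex outside \<open>D\<close> is \<open>v\<close>,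
  so different \<open>v\<close> contribute disjoint families. Otherwise, for every non-neighbour \<open>u\<close> of \<open>v\<close>, the
  \<open>(s-2)\<close>-clique in the common neighbourhood of \<open>u\<close> and \<open>v\<close> contains some \<open>t\<close> outside \<open>D\<close>, and both \<open>vt\<close>
  and \<open>tu\<close> lie in copies of \<open>K\<^bsub>r\<^esub>\<close>. Hence \<open>v\<close> has boundedly many non-neighbours, and a maximal clique
  among such \<open>v\<close> contains a fixed proportion of them. As this clique lies in the union of the copies
  of \<open>K\<^bsub>r\<^esub>\<close> through any of its vertices, it is bounded, and so is the number of such \<open>v\<close>.
\<close>

section \<open>Cliques and copies of complete graphs\<close>

definition cliques :: "nat \<Rightarrow> 'a graph \<Rightarrow> 'a set set" where
  "cliques t G = {X \<in> [fst G]\<^bsup>t\<^esup>. clique X (snd G)}"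

lemma finite_cliques: "simple_graph G \<Longrightarrow> finite (cliques t G)"
  by (simp add: cliques_def simple_graph_def finite_imp_finite_nsets)

lemma smaller_clique_in_cliques:
  assumes "X \<in> cliques t G" and "Y \<subseteq> X"
  shows "Y \<in> cliques (card Y) G"
  using assms by (auto simp: cliques_def nsets_def intro: finite_subset smaller_clique)

lemma clique_iff_nsets_subset: "clique X E \<longleftrightarrow> [X]\<^bsup>2\<^esup> \<subseteq> E"
  by (auto simp: clique_def nsets_2_eq)

lemma graph_iso_complete_graph_iff:
  assumes "simple_graph K"
  shows "graph_iso (complete_graph t) K \<longleftrightarrow> card (fst K) = t \<and> snd K = [fst K]\<^bsup>2\<^esup>"
proof
  assume "graph_iso (complete_graph t) K"
  then obtain f where bij: "bij_betw f {..<t} (fst K)"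
    and edges: "\<And>u v. u < t \<Longrightarrow> v < t \<Longrightarrow> u \<noteq> v \<longleftrightarrow> {f u, f v} \<in> snd K"
    unfolding graph_iso_def complete_graph_def by auto
  have "[fst K]\<^bsup>2\<^esup> \<subseteq> snd K"
  proof
    fix e assume "e \<in> [fst K]\<^bsup>2\<^esup>"
    moreover have "fst K = f ` {..<t}" using bij by (simp add: bij_betw_def)
    ultimately obtain u v where "e = {f u, f v}" "u < t" "v < t" "u \<noteq> v"
      by (auto elim!: nsets2_E)
    then show "e \<in> snd K" using edges by simp
  qed
  then show "card (fst K) = t \<and> snd K = [fst K]\<^bsup>2\<^esup>"
    using bij_betw_same_card[OF bij] assms by (auto simp: simple_graph_def)
next
  assume K: "card (fst K) = t \<and> snd K = [fst K]\<^bsup>2\<^esup>"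
  then obtain f where "bij_betw f {..<t} (fst K)"
    using assms finite_same_card_bij[of "{..<t}" "fst K"] by (auto simp: simple_graph_def)
  then show "graph_iso (complete_graph t) K"
    using K unfolding graph_iso_def complete_graph_def
    by (auto simp: bij_betw_def inj_on_eq_iff intro!: exI[of _ f])
qed

lemma copies_complete_graph:
  assumes "simple_graph G"
  shows "copies (complete_graph t) G = (\<lambda>X. (X, [X]\<^bsup>2\<^esup>)) ` cliques t G"
proof -
  have "K \<in> copies (complete_graph t) G \<longleftrightarrow>
      simple_graph K \<and> fst K \<subseteq> fst G \<and> snd K \<subseteq> snd G \<and> card (fst K) = t \<and> snd K = [fst K]\<^bsup>2\<^esup>" for K
    using graph_iso_complete_graph_iff[of K t] unfolding copies_def subgraph_def by blast
  then show ?thesis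
    by (fastforce simp: cliques_def nsets_def[of _ t] clique_iff_nsets_subset simple_graph_def)
qed

lemma card_copies_complete_graph:
  assumes "simple_graph G"
  shows "card (copies (complete_graph t) G) = card (cliques t G)"
  unfolding copies_complete_graph[OF assms] by (intro card_image inj_onI) simp

section \<open>Strong saturation in terms of links\<close>

definition clique_link :: "nat \<Rightarrow> 'a graph \<Rightarrow> 'a \<Rightarrow> 'a set set" where
  "clique_link t G v = {T. v \<notin> T \<and> insert v T \<in> cliques (Suc t) G}"

lemma mem_clique_link_iff:
  "T \<in> clique_link t G v \<longleftrightarrow> v \<in> fst G - T \<and> T \<in> [fst G]\<^bsup>t\<^esup> \<and> clique (insert v T) (snd G)"
  by (auto simp: clique_link_def cliques_def nsets_def)

lemma clique_insert_edge_iff: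
  assumes "u \<noteq> v" and "{u, v} \<notin> E"
  shows "clique X (insert {u, v} E) \<and> \<not> clique X E \<longleftrightarrow>
    (\<exists>T. X = insert u (insert v T) \<and> u \<notin> T \<and> v \<notin> T \<and> clique (insert u T) E \<and> clique (insert v T) E)"
proof
  assume X: "clique X (insert {u, v} E) \<and> \<not> clique X E"
  then have "u \<in> X" "v \<in> X" by (auto simp: clique_def doubleton_eq_iff)
  moreover have "clique (insert u (X - {u, v})) E" "clique (insert v (X - {u, v})) E"
    using X \<open>u \<in> X\<close> \<open>v \<in> X\<close> assms(1) by (auto simp: clique_def doubleton_eq_iff)
  ultimately show "\<exists>T. X = insert u (insert v T) \<and> u \<notin> T \<and> v \<notin> T \<and>
      clique (insert u T) E \<and> clique (insert v T) E"
    by (intro exI[of _ "X - {u, v}"]) auto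
next
  assume "\<exists>T. X = insert u (insert v T) \<and> u \<notin> T \<and> v \<notin> T \<and>
    clique (insert u T) E \<and> clique (insert v T) E"
  then show "clique X (insert {u, v} E) \<and> \<not> clique X E"
    using assms by (auto simp: clique_def insert_commute)
qed

lemma new_cliques_add_edge:
  assumes "u \<noteq> v" and "{u, v} \<notin> snd G"
  shows "cliques (Suc (Suc t)) (add_edge u v G) - cliques (Suc (Suc t)) G =
    (\<lambda>T. insert u (insert v T)) ` (clique_link t G u \<inter> clique_link t G v)" (is "?new = ?cones")
proof (rule set_eqI)
  fix X
  have "X \<in> ?new \<longleftrightarrow>
      X \<in> [fst G]\<^bsup>Suc (Suc t)\<^esup> \<and> clique X (insert {u, v} (snd G)) \<and> \<not> clique X (snd G)"
    by (auto simp: cliques_def add_edge_def)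
  also have "\<dots> \<longleftrightarrow> (\<exists>T. X = insert u (insert v T) \<and> u \<notin> T \<and> v \<notin> T \<and> X \<in> [fst G]\<^bsup>Suc (Suc t)\<^esup> \<and>
      clique (insert u T) (snd G) \<and> clique (insert v T) (snd G))"
    unfolding clique_insert_edge_iff[OF assms] by blast
  also have "\<dots> \<longleftrightarrow>
      (\<exists>T. X = insert u (insert v T) \<and> T \<in> clique_link t G u \<inter> clique_link t G v)"
    using assms(1) by (intro ex_cong1 conj_cong refl) (auto simp: mem_clique_link_iff nsets_def)
  also have "\<dots> \<longleftrightarrow> X \<in> ?cones" by blast
  finally show "X \<in> ?new \<longleftrightarrow> X \<in> ?cones" .
qed

lemma strongly_saturated_complete_graph_iff:
  assumes "simple_graph G"
  shows "strongly_saturated (complete_graph (Suc (Suc t))) G \<longleftrightarrow>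
    (\<forall>u\<in>fst G. \<forall>v\<in>fst G. u \<noteq> v \<longrightarrow> {u, v} \<notin> snd G \<longrightarrow> clique_link t G u \<inter> clique_link t G v \<noteq> {})"
  unfolding strongly_saturated_def
proof (intro ball_cong refl imp_cong)
  fix u v assume uv: "u \<in> fst G" "v \<in> fst G" "u \<noteq> v" "{u, v} \<notin> snd G"
  then have "simple_graph (add_edge u v G)"
    using assms by (simp add: simple_graph_def add_edge_def)
  then have "(\<exists>K. K \<in> copies (complete_graph (Suc (Suc t))) (add_edge u v G) \<and>
        K \<notin> copies (complete_graph (Suc (Suc t))) G) \<longleftrightarrow>
      cliques (Suc (Suc t)) (add_edge u v G) - cliques (Suc (Suc t)) G \<noteq> {}"
    using assms by (auto simp: copies_complete_graph)
  also have "\<dots> \<longleftrightarrow> clique_link t G u \<inter> clique_link t G v \<noteq> {}"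
    using uv by (simp add: new_cliques_add_edge)
  finally show "(\<exists>K. K \<in> copies (complete_graph (Suc (Suc t))) (add_edge u v G) \<and>
        K \<notin> copies (complete_graph (Suc (Suc t))) G) \<longleftrightarrow>
      clique_link t G u \<inter> clique_link t G v \<noteq> {}" .
qed

section \<open>The upper bound\<close>

definition complete_split_graph :: "nat \<Rightarrow> nat \<Rightarrow> nat graph" where
  "complete_split_graph t n = ({..<n}, {e \<in> [{..<n}]\<^bsup>2\<^esup>. e \<inter> {..<t} \<noteq> {}})"

lemma fst_complete_split_graph [simp]: "fst (complete_split_graph t n) = {..<n}"
  by (simp add: complete_split_graph_def)

lemma edge_complete_split_graph_iff:
  "{u, v} \<in> snd (complete_split_graph t n) \<longleftrightarrow> u < n \<and> v < n \<and> u \<noteq> v \<and> (u < t \<or> v < t)"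
  by (auto simp: complete_split_graph_def)

lemma simple_graph_complete_split_graph: "simple_graph (complete_split_graph t n)"
  by (auto simp: complete_split_graph_def simple_graph_def)

lemma strongly_saturated_complete_split_graph:
  "strongly_saturated (complete_graph (Suc (Suc t))) (complete_split_graph t n)"
  unfolding strongly_saturated_complete_graph_iff[OF simple_graph_complete_split_graph]
proof (intro ballI impI)
  fix u v
  assume "u \<in> fst (complete_split_graph t n)" "v \<in> fst (complete_split_graph t n)"
    "u \<noteq> v" "{u, v} \<notin> snd (complete_split_graph t n)"
  then have "{..<t} \<in> clique_link t (complete_split_graph t n) u \<inter>
      clique_link t (complete_split_graph t n) v"
    by (auto simp: mem_clique_link_iff clique_def edge_complete_split_graph_iff nsets_def)
  then show "clique_link t (complete_split_graph t n) u \<inter>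
      clique_link t (complete_split_graph t n) v \<noteq> {}"
    by blast
qed

lemma cliques_complete_split_graph_subset:
  "cliques (Suc j) (complete_split_graph t n) \<subseteq>
    (\<lambda>(v, Y). insert v Y) ` ({..<n} \<times> [{..<t}]\<^bsup>j\<^esup>) \<union> [{..<t}]\<^bsup>Suc j\<^esup>"
proof
  fix X assume "X \<in> cliques (Suc j) (complete_split_graph t n)"
  then have X: "X \<subseteq> {..<n}" "finite X" "card X = Suc j" "clique X (snd (complete_split_graph t n))"
    by (auto simp: cliques_def nsets_def)
  show "X \<in> (\<lambda>(v, Y). insert v Y) ` ({..<n} \<times> [{..<t}]\<^bsup>j\<^esup>) \<union> [{..<t}]\<^bsup>Suc j\<^esup>"
  proof (cases "X \<subseteq> {..<t}")
    case True
    then show ?thesis using X by (simp add: nsets_def)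
  next
    case False
    then obtain v where v: "v \<in> X" "\<not> v < t" by blast
    then have "X - {v} \<subseteq> {..<t}"
      using X(4) unfolding clique_def edge_complete_split_graph_iff by auto
    then have "X - {v} \<in> [{..<t}]\<^bsup>j\<^esup>" using X v by (simp add: nsets_def)
    moreover have "X = insert v (X - {v})" using v by blast
    ultimately show ?thesis using X(1) v by (intro UnI1 image_eqI[of _ _ "(v, X - {v})"]) auto
  qed
qed

lemma card_cliques_complete_split_graph_le:
  "card (cliques (Suc j) (complete_split_graph t n)) \<le> n * (t choose j) + (t choose Suc j)"
proof -
  have fin: "finite ({..<n} \<times> [{..<t}]\<^bsup>j\<^esup>)" "finite ([{..<t}]\<^bsup>Suc j\<^esup>)"
    by (simp_all add: finite_imp_finite_nsets)
  have "card (cliques (Suc j) (complete_split_graph t n)) \<le>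
      card ((\<lambda>(v, Y). insert v Y) ` ({..<n} \<times> [{..<t}]\<^bsup>j\<^esup>) \<union> [{..<t}]\<^bsup>Suc j\<^esup>)"
    using fin by (intro card_mono cliques_complete_split_graph_subset) blast
  also have "\<dots> \<le> card ({..<n} \<times> [{..<t}]\<^bsup>j\<^esup>) + card ([{..<t}]\<^bsup>Suc j\<^esup>)"
    by (intro order_trans[OF card_Un_le] add_right_mono card_image_le fin)
  finally show ?thesis by (simp add: card_cartesian_product card_nsets)
qed

lemma ssat_le:
  fixes G :: "nat graph"
  assumes "simple_graph G" and "strongly_saturated F G"
  shows "ssat (card (fst G)) H F \<le> card (copies H G)"
  unfolding ssat_def using assms by (intro cInf_lower CollectI exI[of _ G]) simp_all

lemma ssat_complete_graph_le:
  "ssat n (complete_graph (Suc j)) (complete_graph (Suc (Suc t))) \<le> n * (t choose j) + (t choose Suc j)"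
  using ssat_le[OF simple_graph_complete_split_graph strongly_saturated_complete_split_graph,
      of t n "complete_graph (Suc j)"]
    card_cliques_complete_split_graph_le[of j t n]
  by (simp add: card_copies_complete_graph simple_graph_complete_split_graph)

section \<open>Vertices in few and in many cliques\<close>

definition cliques_at :: "nat \<Rightarrow> 'a graph \<Rightarrow> 'a \<Rightarrow> 'a set set" where
  "cliques_at r G v = {X \<in> cliques r G. v \<in> X}"

definition clique_neighbourhood :: "nat \<Rightarrow> 'a graph \<Rightarrow> 'a \<Rightarrow> 'a set" where
  "clique_neighbourhood r G v = \<Union>(cliques_at r G v)"

lemma clique_neighbourhood_subset: "clique_neighbourhood r G v \<subseteq> fst G"
  by (auto simp: clique_neighbourhood_def cliques_at_def cliques_def nsets_def)

lemma finite_clique_neighbourhood: "simple_graph G \<Longrightarrow> finite (clique_neighbourhood r G v)"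
  using clique_neighbourhood_subset finite_subset unfolding simple_graph_def by metis

lemma card_clique_neighbourhood_le:
  "card (clique_neighbourhood r G v) \<le> card (cliques_at r G v) * r"
proof -
  have "card (clique_neighbourhood r G v) \<le> (\<Sum>X\<in>cliques_at r G v. card X)"
    unfolding clique_neighbourhood_def by (rule card_Union_le_sum_card)
  also have "\<dots> = card (cliques_at r G v) * r"
    by (simp add: cliques_at_def cliques_def nsets_def)
  finally show ?thesis .
qed

lemma clique_subset_clique_neighbourhood:
  assumes "Z \<in> cliques t G" and "v \<in> Z" and "2 \<le> r" and "r \<le> t"
  shows "Z \<subseteq> clique_neighbourhood r G v"
proof
  fix w assume "w \<in> Z"
  have Z: "finite Z" "card Z = t" using assms(1) by (auto simp: cliques_def nsets_def)
  have "card {v, w} \<le> r" using \<open>2 \<le> r\<close> by (simp add: card_insert_if)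
  then obtain Y where "{v, w} \<subseteq> Y" "Y \<subseteq> Z" "card Y = r"
    using exists_subset_between[of "{v, w}" r Z] Z \<open>v \<in> Z\<close> \<open>w \<in> Z\<close> \<open>r \<le> t\<close> by auto
  then show "w \<in> clique_neighbourhood r G v"
    using smaller_clique_in_cliques[OF assms(1)] by (auto simp: clique_neighbourhood_def cliques_at_def)
qed

definition heavy_vertices :: "nat \<Rightarrow> nat \<Rightarrow> 'a graph \<Rightarrow> 'a set" where
  "heavy_vertices K r G = {v \<in> fst G. K \<le> card (cliques_at r G v)}"

lemma card_heavy_vertices_le:
  assumes "simple_graph G"
  shows "K * card (heavy_vertices K r G) \<le> r * card (cliques r G)"
proof -
  have fin: "finite (fst G)" using assms by (simp add: simple_graph_def)
  have "K * card (heavy_vertices K r G) \<le> (\<Sum>v\<in>heavy_vertices K r G. card (cliques_at r G v))"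
    using sum_bounded_below[of "heavy_vertices K r G" K "\<lambda>v. card (cliques_at r G v)"]
    by (simp add: heavy_vertices_def mult.commute)
  also have "\<dots> \<le> (\<Sum>v\<in>fst G. card (cliques_at r G v))"
    using fin by (intro sum_mono2) (auto simp: heavy_vertices_def)
  also have "\<dots> = r * card (cliques r G)"
    unfolding cliques_at_def
  proof (rule sum_multicount[OF fin finite_cliques[OF assms]], rule ballI)
    fix X assume "X \<in> cliques r G"
    then have "{v \<in> fst G. v \<in> X} = X" "card X = r" by (auto simp: cliques_def nsets_def)
    then show "card {v \<in> fst G. v \<in> X} = r" by simp
  qed
  finally show ?thesis .
qed

lemma card_clique_neighbourhood_not_heavy_le:
  assumes "v \<in> fst G - heavy_vertices K r G"
  shows "card (clique_neighbourhood r G v) \<le> K * r"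
proof -
  have "card (cliques_at r G v) \<le> K" using assms by (auto simp: heavy_vertices_def)
  then show ?thesis using card_clique_neighbourhood_le mult_le_mono1 order_trans by metis
qed

section \<open>Anchored and unanchored vertices\<close>

definition anchored :: "nat \<Rightarrow> 'a graph \<Rightarrow> 'a set \<Rightarrow> 'a set" where
  "anchored t G D = {v \<in> fst G - D. \<exists>T\<in>clique_link t G v. T \<subseteq> D}"

definition unanchored :: "nat \<Rightarrow> 'a graph \<Rightarrow> 'a set \<Rightarrow> 'a set" where
  "unanchored t G D = fst G - D - anchored t G D"

lemma inj_on_insert_outside: "inj_on (\<lambda>(v, Y). insert v Y) (SIGMA v:- D. Pow D)"
proof (rule inj_on_inverseI)
  fix p assume "p \<in> (SIGMA v:- D. Pow D)"
  then obtain v Y where "p = (v, Y)" "v \<notin> D" "Y \<subseteq> D" by auto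
  then show "(\<lambda>X. (the_elem (X - D), X \<inter> D)) ((\<lambda>(v, Y). insert v Y) p) = p"
    by (simp add: insert_Diff_if Int_absorb2 Diff_eq_empty_iff[THEN iffD2])
qed

lemma binomial_mult_card_anchored_le_card_cliques:
  assumes "simple_graph G"
  shows "(t choose j) * card (anchored t G D) \<le> card (cliques (Suc j) G)"
proof -
  have "\<exists>T. \<forall>v\<in>anchored t G D. T v \<in> clique_link t G v \<and> T v \<subseteq> D"
    by (rule bchoice) (auto simp: anchored_def)
  then obtain T where T: "T v \<in> clique_link t G v" "T v \<subseteq> D" if "v \<in> anchored t G D" for v
    by blast
  have T_card: "finite (T v)" "card (T v) = t" if "v \<in> anchored t G D" for v
    using T(1)[OF that] by (auto simp: mem_clique_link_iff nsets_def)
  let ?S = "SIGMA v:anchored t G D. [T v]\<^bsup>j\<^esup>"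
  have "finite (anchored t G D)" using assms by (auto simp: anchored_def simple_graph_def)
  then have "card ?S = (\<Sum>v\<in>anchored t G D. card ([T v]\<^bsup>j\<^esup>))"
    using T_card by (intro card_SigmaI) (auto simp: finite_imp_finite_nsets)
  also have "\<dots> = (t choose j) * card (anchored t G D)"
    using T_card by (simp add: card_nsets)
  finally have "(t choose j) * card (anchored t G D) = card ?S" ..
  also have "\<dots> = card ((\<lambda>(v, Y). insert v Y) ` ?S)"
  proof (rule card_image[symmetric], rule inj_on_subset[OF inj_on_insert_outside], rule Sigma_mono)
    show "anchored t G D \<subseteq> - D" by (auto simp: anchored_def)
    show "[T v]\<^bsup>j\<^esup> \<subseteq> Pow D" if "v \<in> anchored t G D" for v
      using T(2)[OF that] by (auto simp: nsets_def)
  qed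
  also have "\<dots> \<le> card (cliques (Suc j) G)"
  proof (intro card_mono finite_cliques[OF assms], clarify)
    fix v Y assume v: "v \<in> anchored t G D" and "Y \<in> [T v]\<^bsup>j\<^esup>"
    then have Y: "Y \<subseteq> T v" "finite Y" "card Y = j" by (auto simp: nsets_def)
    have "v \<notin> T v" "insert v (T v) \<in> cliques (Suc t) G"
      using T(1)[OF v] by (auto simp: clique_link_def)
    moreover have "card (insert v Y) = Suc j" using Y \<open>v \<notin> T v\<close> by (subst card_insert_disjoint) auto
    ultimately show "insert v Y \<in> cliques (Suc j) G"
      using smaller_clique_in_cliques[of "insert v (T v)" "Suc t" G "insert v Y"] Y(1) by auto
  qed
  finally show ?thesis .
qed

lemma card_UN_le_mult:
  assumes "finite I" and "card I \<le> a" and "\<And>i. i \<in> I \<Longrightarrow> card (A i) \<le> b"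
  shows "card (\<Union>i\<in>I. A i) \<le> a * b"
proof -
  have "card (\<Union>i\<in>I. A i) \<le> (\<Sum>i\<in>I. card (A i))" by (rule card_UN_le[OF assms(1)])
  also have "\<dots> \<le> card I * b" using sum_bounded_above[of I "\<lambda>i. card (A i)" b] assms(3) by simp
  also have "\<dots> \<le> a * b" using assms(2) by simp
  finally show ?thesis .
qed

text \<open>In a simple graph every vertex is among its own non-neighbours.\<close>

definition nonneighbours :: "'a graph \<Rightarrow> 'a \<Rightarrow> 'a set" where
  "nonneighbours G v = {u \<in> fst G. {v, u} \<notin> snd G}"

lemma nonneighbours_unanchored_subset:
  assumes G: "simple_graph G" and sat: "strongly_saturated (complete_graph (Suc (Suc t))) G"
    and r: "2 \<le> r" "r \<le> Suc t" and v: "v \<in> unanchored t G D"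
  shows "nonneighbours G v \<subseteq>
    insert v (\<Union>w\<in>clique_neighbourhood r G v - D. clique_neighbourhood r G w)"
proof
  fix u assume u: "u \<in> nonneighbours G v"
  show "u \<in> insert v (\<Union>w\<in>clique_neighbourhood r G v - D. clique_neighbourhood r G w)"
  proof (cases "u = v")
    case False
    moreover have "v \<in> fst G" using v by (simp add: unanchored_def)
    ultimately have "clique_link t G v \<inter> clique_link t G u \<noteq> {}"
      using sat u unfolding strongly_saturated_complete_graph_iff[OF G]
      by (simp add: nonneighbours_def)
    then obtain T where T: "T \<in> clique_link t G v" "T \<in> clique_link t G u" by blast
    then obtain w where w: "w \<in> T" "w \<notin> D"
      using v by (auto simp: unanchored_def anchored_def)
    have "insert v T \<subseteq> clique_neighbourhood r G v"
      using T(1) by (intro clique_subset_clique_neighbourhood[OF _ _ r]) (auto simp: clique_link_def)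
    moreover have "insert u T \<subseteq> clique_neighbourhood r G w"
      using T(2) w(1)
      by (intro clique_subset_clique_neighbourhood[OF _ _ r]) (auto simp: clique_link_def)
    ultimately show ?thesis using w by blast
  qed simp
qed

lemma card_nonneighbours_unanchored_le:
  assumes G: "simple_graph G" and sat: "strongly_saturated (complete_graph (Suc (Suc t))) G"
    and r: "2 \<le> r" "r \<le> Suc t"
    and small: "\<And>v. v \<in> fst G - D \<Longrightarrow> card (clique_neighbourhood r G v) \<le> d"
    and v: "v \<in> unanchored t G D"
  shows "card (nonneighbours G v) \<le> Suc (d * d)"
proof -
  let ?W = "clique_neighbourhood r G v - D"
  note fin = finite_clique_neighbourhood[OF G]
  have "card (nonneighbours G v) \<le> card (insert v (\<Union>w\<in>?W. clique_neighbourhood r G w))"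
    using fin by (intro card_mono nonneighbours_unanchored_subset[OF G sat r v]) auto
  also have "\<dots> \<le> Suc (card (\<Union>w\<in>?W. clique_neighbourhood r G w))"
    by (rule card_insert_le_m1) auto
  also have "card (\<Union>w\<in>?W. clique_neighbourhood r G w) \<le> d * d"
  proof (rule card_UN_le_mult)
    show "finite ?W" using fin by blast
    have "card ?W \<le> card (clique_neighbourhood r G v)" using fin by (intro card_mono) auto
    also have "\<dots> \<le> d" using v by (intro small) (simp add: unanchored_def)
    finally show "card ?W \<le> d" .
    show "card (clique_neighbourhood r G w) \<le> d" if "w \<in> ?W" for w
      using that clique_neighbourhood_subset[of r G v] by (intro small) blast
  qed
  finally show ?thesis by simp
qed

lemma exists_clique_if_few_nonneighbours:
  assumes G: "simple_graph G" and A: "A \<subseteq> fst G"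
    and few: "\<And>v. v \<in> A \<Longrightarrow> card (nonneighbours G v) \<le> m"
  shows "\<exists>Y\<subseteq>A. clique Y (snd G) \<and> card A \<le> card Y * m"
proof -
  have fin: "finite (fst G)" "finite A"
    using G A finite_subset[of A "fst G"] by (simp_all add: simple_graph_def)
  let ?S = "{Y \<in> Pow A. clique Y (snd G)}"
  have "\<exists>Y\<in>?S. \<forall>Z\<in>?S. Y \<subseteq> Z \<longrightarrow> Y = Z"
    using fin null_clique by (intro finite_has_maximal) auto
  then obtain Y where "Y \<in> ?S" and maximal: "\<forall>Z\<in>?S. Y \<subseteq> Z \<longrightarrow> Y = Z" by blast
  then have Y: "Y \<subseteq> A" "clique Y (snd G)" "finite Y"
    using fin(2) by (auto intro: finite_subset)
  have "A \<subseteq> (\<Union>v\<in>Y. nonneighbours G v)"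
  proof
    fix u assume u: "u \<in> A"
    have "\<exists>v\<in>Y. {v, u} \<notin> snd G"
    proof (rule ccontr)
      assume "\<not> ?thesis"
      then have adjacent: "\<forall>v\<in>Y. {v, u} \<in> snd G" by blast
      then have "clique (insert u Y) (snd G)"
        using Y(2) by (auto simp: clique_def insert_commute)
      then have "u \<in> Y" using maximal u Y(1) by blast
      then have "{u, u} \<in> snd G" using adjacent by blast
      then show False
        using G doubleton_in_nsets_2[of u u "fst G"] unfolding simple_graph_def by blast
    qed
    then show "u \<in> (\<Union>v\<in>Y. nonneighbours G v)"
      using u A by (auto simp: nonneighbours_def)
  qed
  then have "card A \<le> card (\<Union>v\<in>Y. nonneighbours G v)"
    using fin(1) Y(3) by (intro card_mono) (auto simp: nonneighbours_def)
  also have "\<dots> \<le> card Y * m"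
    using Y few by (intro card_UN_le_mult) auto
  finally show ?thesis using Y by blast
qed

lemma card_unanchored_le:
  assumes G: "simple_graph G" and sat: "strongly_saturated (complete_graph (Suc (Suc t))) G"
    and r: "2 \<le> r" "r \<le> Suc t"
    and small: "\<And>v. v \<in> fst G - D \<Longrightarrow> card (clique_neighbourhood r G v) \<le> d"
  shows "card (unanchored t G D) \<le> max r d * Suc (d * d)"
proof -
  have sub: "unanchored t G D \<subseteq> fst G" by (auto simp: unanchored_def)
  have "card (nonneighbours G v) \<le> Suc (d * d)" if "v \<in> unanchored t G D" for v
    using card_nonneighbours_unanchored_le[OF assms that] .
  then obtain Y where Y: "Y \<subseteq> unanchored t G D" "clique Y (snd G)"
    and large: "card (unanchored t G D) \<le> card Y * Suc (d * d)"
    using exists_clique_if_few_nonneighbours[OF G sub] by blast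
  have "card Y \<le> max r d"
  proof (cases "r \<le> card Y")
    case True
    then obtain v where v: "v \<in> Y" using r(1) by fastforce
    have "finite Y" using finite_subset[of Y "fst G"] G Y(1) sub by (auto simp: simple_graph_def)
    then have "Y \<in> cliques (card Y) G" using Y sub by (auto simp: cliques_def nsets_def)
    then have "card Y \<le> card (clique_neighbourhood r G v)"
      using True v r(1)
      by (intro card_mono finite_clique_neighbourhood[OF G] clique_subset_clique_neighbourhood)
    also have "\<dots> \<le> d" using v Y(1) by (intro small) (auto simp: unanchored_def)
    finally show ?thesis by simp
  qed simp
  then show ?thesis using large mult_le_mono1 order_trans by blast
qed

section \<open>The lower bound\<close>

lemma strongly_saturated_imp_card_cliques_ge:
  assumes G: "simple_graph G" and sat: "strongly_saturated (complete_graph (Suc (Suc t))) G"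
    and j: "1 \<le> j" "j \<le> t" and D: "D \<subseteq> fst G"
    and small: "\<And>v. v \<in> fst G - D \<Longrightarrow> card (clique_neighbourhood (Suc j) G v) \<le> d"
  shows "(t choose j) * card (fst G) \<le>
    card (cliques (Suc j) G) + (t choose j) * (card D + max (Suc j) d * Suc (d * d))"
proof -
  have "fst G = anchored t G D \<union> (D \<union> unanchored t G D)"
    using D by (auto simp: anchored_def unanchored_def)
  then have "card (fst G) = card (anchored t G D \<union> (D \<union> unanchored t G D))"
    by (rule arg_cong)
  also have "\<dots> \<le> card (anchored t G D) + (card D + card (unanchored t G D))"
    by (rule order_trans[OF card_Un_le add_left_mono[OF card_Un_le]])
  also have "\<dots> \<le> card (anchored t G D) + (card D + max (Suc j) d * Suc (d * d))"
    using j by (intro add_left_mono card_unanchored_le[OF G sat _ _ small]) simp_all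
  finally have "(t choose j) * card (fst G) \<le>
      (t choose j) * (card (anchored t G D) + (card D + max (Suc j) d * Suc (d * d)))"
    by (rule mult_le_mono2)
  also have "\<dots> = (t choose j) * card (anchored t G D) +
      (t choose j) * (card D + max (Suc j) d * Suc (d * d))"
    by (rule add_mult_distrib2)
  also have "(t choose j) * card (anchored t G D) \<le> card (cliques (Suc j) G)"
    by (rule binomial_mult_card_anchored_le_card_cliques[OF G])
  finally show ?thesis by simp
qed

lemma ssat_complete_graph_ge:
  assumes "1 \<le> j" and "j \<le> t"
  shows "\<exists>C. \<forall>n. K * ((t choose j) * n) \<le>
    (K + (t choose j) * Suc j) * ssat n (complete_graph (Suc j)) (complete_graph (Suc (Suc t))) + C"
proof (intro exI allI)
  fix n
  let ?M = "t choose j" and ?d = "K * Suc j"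
  let ?b = "max (Suc j) ?d * Suc (?d * ?d)"
  obtain G :: "nat graph" where G: "simple_graph G" "card (fst G) = n"
    "strongly_saturated (complete_graph (Suc (Suc t))) G"
    "card (copies (complete_graph (Suc j)) G) =
      ssat n (complete_graph (Suc j)) (complete_graph (Suc (Suc t)))"
    using ssat_attained by blast
  let ?D = "heavy_vertices K (Suc j) G" and ?N = "card (cliques (Suc j) G)"
  have "?D \<subseteq> fst G" by (auto simp: heavy_vertices_def)
  then have "?M * n \<le> ?N + ?M * (card ?D + ?b)"
    using strongly_saturated_imp_card_cliques_ge[OF G(1,3) assms _ card_clique_neighbourhood_not_heavy_le]
    unfolding G(2) by blast
  then have "K * (?M * n) \<le> K * (?N + ?M * (card ?D + ?b))" by (rule mult_le_mono2)
  also have "\<dots> = K * ?N + ?M * (K * card ?D) + K * ?M * ?b" by (simp add: algebra_simps)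
  also have "\<dots> \<le> K * ?N + ?M * (Suc j * ?N) + K * ?M * ?b"
    by (intro add_mono mult_le_mono2 card_heavy_vertices_le[OF G(1)] order_refl)
  also have "\<dots> = (K + ?M * Suc j) * ?N + K * ?M * ?b" by (simp add: algebra_simps)
  finally show "K * (?M * n) \<le> (K + ?M * Suc j) *
      ssat n (complete_graph (Suc j)) (complete_graph (Suc (Suc t))) + K * ?M * ?b"
    using card_copies_complete_graph[OF G(1)] G(4) by metis
qed

lemma ssat_complete_graph_deficit_le:
  assumes "1 \<le> j" and "j \<le> t" and "0 < \<epsilon>"
  shows "\<exists>C. \<forall>n. real n * real (t choose j)
    - real (ssat n (complete_graph (Suc j)) (complete_graph (Suc (Suc t)))) \<le> \<epsilon> * real n + C"
proof -
  let ?M = "t choose j" and ?N = "\<lambda>n. ssat n (complete_graph (Suc j)) (complete_graph (Suc (Suc t)))"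
  define a where "a = ?M * Suc j"
  obtain K :: nat where "real (a * ?M) / \<epsilon> < real K" using reals_Archimedean2 by blast
  moreover have "0 \<le> real (a * ?M) / \<epsilon>" using \<open>0 < \<epsilon>\<close> by simp
  ultimately have K: "real (a * ?M) \<le> \<epsilon> * real K" "0 < real K"
    using \<open>0 < \<epsilon>\<close> by (simp add: field_simps, linarith)
  obtain C where C: "K * (?M * n) \<le> (K + a) * ?N n + C" for n
    using ssat_complete_graph_ge[OF assms(1,2)] unfolding a_def by blast
  let ?c = "real (a * (t choose Suc j) + C)"
  have "real n * real ?M - real (?N n) \<le> \<epsilon> * real n + ?c / real K" for n
  proof -
    have "K * (?M * n) \<le> K * ?N n + a * ?N n + C" using C[of n] by (simp add: algebra_simps)
    also have "a * ?N n \<le> a * (n * ?M + (t choose Suc j))"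
      by (intro mult_le_mono2 ssat_complete_graph_le)
    finally have "real (K * (?M * n)) \<le> real (K * ?N n + a * (n * ?M + (t choose Suc j)) + C)"
      by (simp only: of_nat_le_iff)
    then have "real K * (real n * real ?M - real (?N n)) \<le> real (a * ?M) * real n + ?c"
      by (simp add: algebra_simps)
    also have "\<dots> \<le> \<epsilon> * real K * real n + ?c" using K(1) by (intro add_right_mono mult_right_mono) auto
    also have "\<dots> = real K * (\<epsilon> * real n + ?c / real K)" using K(2) by (simp add: field_simps)
    finally show ?thesis using K(2) by simp
  qed
  then show ?thesis by blast
qed

lemma smallo_real_if_affine_bounds:
  fixes f :: "nat \<Rightarrow> real"
  assumes "\<And>\<epsilon>. 0 < \<epsilon> \<Longrightarrow> \<exists>C. \<forall>n. \<bar>f n\<bar> \<le> \<epsilon> * real n + C"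
  shows "f \<in> o(real)"
proof (rule landau_o.smallI)
  fix \<epsilon> :: real assume "0 < \<epsilon>"
  then obtain C where C: "\<bar>f n\<bar> \<le> \<epsilon> / 2 * real n + C" for n
    using assms[of "\<epsilon> / 2"] by auto
  have "eventually (\<lambda>n. 2 * C / \<epsilon> \<le> real n) sequentially"
    by (rule eventually_compose_filterlim[OF eventually_ge_at_top filterlim_real_sequentially])
  then show "eventually (\<lambda>n. norm (f n) \<le> \<epsilon> * norm (real n)) sequentially"
  proof eventually_elim
    case (elim n)
    then have "C \<le> \<epsilon> / 2 * real n" using \<open>0 < \<epsilon>\<close> by (simp add: field_simps)
    then show ?case using C[of n] by simp
  qed
qed

theorem theorem1p4:
  fixes r s :: nat
  assumes "2 \<le> r" and "r < s"
  shows "(\<lambda>n. real n * real ((s - 2) choose (r - 1))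
             - real (ssat n (complete_graph r) (complete_graph s))) \<in> o(\<lambda>n. real n)"
proof (rule smallo_real_if_affine_bounds)
  fix \<epsilon> :: real assume "0 < \<epsilon>"
  define t j where "t = s - 2" and "j = r - 1"
  have s: "s = Suc (Suc t)" and r: "r = Suc j" and j: "1 \<le> j" "j \<le> t"
    using assms by (simp_all add: t_def j_def)
  let ?f = "\<lambda>n. real n * real (t choose j) - real (ssat n (complete_graph r) (complete_graph s))"
  obtain C where lower: "?f n \<le> \<epsilon> * real n + C" for n
    using ssat_complete_graph_deficit_le[OF j \<open>0 < \<epsilon>\<close>] unfolding r s by blast
  have upper: "- ?f n \<le> real (t choose Suc j)" for n
    using of_nat_mono[OF ssat_complete_graph_le[of n j t], where 'a = real] unfolding r s by simp
  have "\<bar>?f n\<bar> \<le> \<epsilon> * real n + (\<bar>C\<bar> + real (t choose Suc j))" for n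
    using lower[of n] upper[of n] \<open>0 < \<epsilon>\<close> by (simp add: abs_le_iff add_increasing)
  then show "\<exists>C. \<forall>n. \<bar>real n * real ((s - 2) choose (r - 1))
      - real (ssat n (complete_graph r) (complete_graph s))\<bar> \<le> \<epsilon> * real n + C"
    unfolding t_def j_def by blast
qed

end
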